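(* Let $X$ be a metrizable completely Baire space and $Y$ a regular space. If $f \colon X \to Y$ is $\mathbf{\Sigma}^0_2$-measurable and not piecewise continuous, then there is a zero-dimensional separable closed set $K \subset X$ such that the restriction $f \upharpoonright K \colon K \to Y$ is $\mathbf{\Sigma}^0_2$-measurable and not piecewise continuous.
   Context: Mappings are not assumed continuous. Regular spaces are understood in the sense of Engelking's "General Topology" (in particular, they are $T_1$). A topological space $X$ is a Baire space if the intersection of countably many dense open sets in $X$ is dense. A space $X$ is completely Baire if every closed subspace of $X$ is a Baire space. A mapping $f \colon X \to Y$ is $\mathbf{\Sigma}^0_2$-measurable if $f^{-1}(U) \in \mathbf{\Sigma}^0_2(X)$, i.e. $f^{-1}(U)$ is an $F_\sigma$-set in $X$, for every open set $U \subset Y$. It is piecewise continuous if $X$ can be covered by a sequence $X_0, X_1, \ldots$ of closed sets such that the restriction $f \upharpoonright X_n$ is continuous for every $n \in \omega$. For the restriction $f \upharpoonright K$ these notions are taken with respect to the subspace $K$. Zero-dimensional: having a base of clopen sets (for separable metrizable spaces this agrees with covering dimension $0$ in the nonempty case). *)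

theory Defs
  imports "HOL-Analysis.Analysis"
begin

definition Baire_space :: "'a topology \<Rightarrow> bool" where
  "Baire_space X \<longleftrightarrow>
     (\<forall>\<G>. countable \<G> \<and> (\<forall>U\<in>\<G>. openin X U \<and> X closure_of U = topspace X)
        \<longrightarrow> X closure_of (topspace X \<inter> \<Inter>\<G>) = topspace X)"

definition completely_Baire_space :: "'a topology \<Rightarrow> bool" where
  "completely_Baire_space X \<longleftrightarrow> (\<forall>C. closedin X C \<longrightarrow> Baire_space (subtopology X C))"

(* As in continuous_map, the next two definitions concern only the values of f on
   topspace X and require that these lie in topspace Y. *)

definition Sigma02_measurable_map :: "'a topology \<Rightarrow> 'b topology \<Rightarrow> ('a \<Rightarrow> 'b) \<Rightarrow> bool" where
  "Sigma02_measurable_map X Y f \<longleftrightarrow>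
     f \<in> topspace X \<rightarrow> topspace Y \<and>
     (\<forall>U. openin Y U \<longrightarrow> fsigma_in X {x \<in> topspace X. f x \<in> U})"

definition piecewise_continuous_map :: "'a topology \<Rightarrow> 'b topology \<Rightarrow> ('a \<Rightarrow> 'b) \<Rightarrow> bool" where
  "piecewise_continuous_map X Y f \<longleftrightarrow>
     (\<exists>C :: nat \<Rightarrow> 'a set. (\<forall>n. closedin X (C n)) \<and> (\<Union>n. C n) = topspace X \<and>
        (\<forall>n. continuous_map (subtopology X (C n)) Y f))"

definition zero_dimensional_space :: "'a topology \<Rightarrow> bool" where
  "zero_dimensional_space X \<longleftrightarrow>
     (\<exists>\<B>. (\<forall>U\<in>\<B>. openin X U \<and> closedin X U) \<and>
          openin X = arbitrary union_of (\<lambda>U. U \<in> \<B>))"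

lemma zero_dimensional_space_iff_dim_le_0: "zero_dimensional_space X \<longleftrightarrow> X dim_le 0"
proof
  assume "zero_dimensional_space X"
  then obtain \<B> where clopen: "\<forall>U\<in>\<B>. openin X U \<and> closedin X U"
    and "openin X = arbitrary union_of (\<lambda>U. U \<in> \<B>)"
    unfolding zero_dimensional_space_def by auto
  then have base: "\<And>W x. openin X W \<Longrightarrow> x \<in> W \<Longrightarrow> \<exists>U. U \<in> \<B> \<and> x \<in> U \<and> U \<subseteq> W"
    unfolding openin_topology_base_unique by meson
  show "X dim_le 0"
    unfolding dimension_le_0_neighbourhood_base_of_clopen neighbourhood_base_of
  proof (intro allI impI)
    fix W x
    assume "openin X W \<and> x \<in> W"
    then obtain U where U: "U \<in> \<B>" "x \<in> U" "U \<subseteq> W"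
      using base by meson
    show "\<exists>U V. openin X U \<and> (closedin X V \<and> openin X V) \<and> x \<in> U \<and> U \<subseteq> V \<and> V \<subseteq> W"
      by (rule exI[of _ U], rule exI[of _ U]) (use U clopen in simp)
  qed
next
  assume "X dim_le 0"
  then have nbhd: "\<And>W x. openin X W \<Longrightarrow> x \<in> W \<Longrightarrow>
      \<exists>U V. openin X U \<and> (closedin X V \<and> openin X V) \<and> x \<in> U \<and> U \<subseteq> V \<and> V \<subseteq> W"
    by (simp add: dimension_le_0_neighbourhood_base_of_clopen neighbourhood_base_of)
  have "openin X = arbitrary union_of (\<lambda>U. U \<in> {U. openin X U \<and> closedin X U})"
    unfolding openin_topology_base_unique
  proof (intro conjI allI impI)
    fix W x
    assume "openin X W \<and> x \<in> W"
    then obtain U V where "closedin X V" "openin X V" "x \<in> U" "U \<subseteq> V" "V \<subseteq> W"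
      using nbhd by meson
    then show "\<exists>V. V \<in> {U. openin X U \<and> closedin X U} \<and> x \<in> V \<and> V \<subseteq> W"
      by (intro exI[of _ V]) auto
  qed simp
  then show "zero_dimensional_space X"
    unfolding zero_dimensional_space_def
    by (intro exI[of _ "{U. openin X U \<and> closedin X U}"] conjI) simp_all
qed

end

theory Submission
  imports Defs
begin

text \<open>Restricting to the complement of the largest open set on which \<open>f\<close> is piecewise continuous, we
  may assume that the set \<open>D\<close> of discontinuity points of \<open>f\<close> is dense. Regularity of the target then
  forces \<open>f\<close> restricted to \<open>D\<close> to have no continuity point at all: if it had one, \<open>f\<close> would be
  discontinuous there along continuity points of \<open>f\<close>, and these can be moved into \<open>D\<close>. Thinning
  out \<open>D\<close>, one gets a countable set \<open>N\<close> on which \<open>f\<close> is nowhere continuous and whose closure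
  \<open>K\<close> is zero-dimensional. As \<open>K\<close> is a Baire space, \<open>f\<close> is not piecewise continuous on \<open>K\<close>.\<close>

section \<open>Countable closed covers with continuous restrictions\<close>

text \<open>The pieces are closed in \<open>X\<close>, not in \<open>A\<close>, and may overshoot
  \<open>A\<close>. Hence the sets \<open>A\<close> with this property form a sigma-ideal, and for
  \<open>A = topspace X\<close> the notion is piecewise continuity.\<close>

definition closed_cover_continuous :: "'a topology \<Rightarrow> 'b topology \<Rightarrow> ('a \<Rightarrow> 'b) \<Rightarrow> 'a set \<Rightarrow> bool" where
  "closed_cover_continuous X Y f A \<longleftrightarrow>
     (\<exists>C :: nat \<Rightarrow> 'a set. (\<forall>n. closedin X (C n) \<and> continuous_map (subtopology X (C n)) Y f) \<and>
        A \<subseteq> (\<Union>n. C n))"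

lemma piecewise_continuous_map_iff:
  "piecewise_continuous_map X Y f \<longleftrightarrow> closed_cover_continuous X Y f (topspace X)"
  unfolding piecewise_continuous_map_def closed_cover_continuous_def
  by (metis (no_types, lifting) UN_least closedin_subset order_antisym order_refl)

lemma closed_cover_continuous_subset:
  "closed_cover_continuous X Y f A \<Longrightarrow> B \<subseteq> A \<Longrightarrow> closed_cover_continuous X Y f B"
  unfolding closed_cover_continuous_def by (meson order_trans)

lemma closed_cover_continuous_piece:
  "closedin X C \<Longrightarrow> continuous_map (subtopology X C) Y f \<Longrightarrow> closed_cover_continuous X Y f C"
  unfolding closed_cover_continuous_def by (rule exI[of _ "\<lambda>_. C"]) auto

lemma closed_cover_continuous_UN:
  assumes "\<And>n::nat. closed_cover_continuous X Y f (A n)"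
  shows "closed_cover_continuous X Y f (\<Union>n. A n)"
proof -
  obtain C :: "nat \<Rightarrow> nat \<Rightarrow> 'a set"
    where C: "\<And>n m. closedin X (C n m)" "\<And>n m. continuous_map (subtopology X (C n m)) Y f"
      "\<And>n. A n \<subseteq> (\<Union>m. C n m)"
    using assms unfolding closed_cover_continuous_def by metis
  let ?D = "\<lambda>k. C (fst (prod_decode k)) (snd (prod_decode k))"
  have "(\<Union>n. A n) \<subseteq> (\<Union>k. ?D k)"
  proof
    fix x assume "x \<in> (\<Union>n. A n)"
    then obtain n m where "x \<in> C n m"
      using C(3) by blast
    then have "x \<in> ?D (prod_encode (n, m))"
      by simp
    then show "x \<in> (\<Union>k. ?D k)"
      by blast
  qed
  then show ?thesis
    unfolding closed_cover_continuous_def using C(1,2) by (intro exI[of _ ?D]) auto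
qed

lemma closed_cover_continuous_Un:
  assumes "closed_cover_continuous X Y f A" "closed_cover_continuous X Y f B"
  shows "closed_cover_continuous X Y f (A \<union> B)"
proof -
  have "closed_cover_continuous X Y f (\<Union>n::nat. if n = 0 then A else B)"
    using assms by (intro closed_cover_continuous_UN) auto
  then show ?thesis
    by (rule closed_cover_continuous_subset) (auto intro: exI[of _ "1::nat"])
qed

text \<open>The index set \<open>I\<close> may be uncountable: local finiteness makes the union
  closed and allows pasting, so a whole family counts as a single piece of a countable
  cover.\<close>

lemma locally_finite_closed_pieces:
  assumes fin: "\<And>x. x \<in> topspace X \<Longrightarrow> \<exists>V. openin X V \<and> x \<in> V \<and> finite {i \<in> I. T i \<inter> V \<noteq> {}}"
    and clo: "\<And>i. i \<in> I \<Longrightarrow> closedin X (T i)"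
    and cont: "\<And>i. i \<in> I \<Longrightarrow> continuous_map (subtopology X (T i)) Y f"
  shows "closedin X (\<Union>i\<in>I. T i)"
    and "continuous_map (subtopology X (\<Union>i\<in>I. T i)) Y f"
proof -
  have "locally_finite_in X (T ` I)"
    unfolding locally_finite_in_def
  proof (intro conjI ballI)
    show "\<Union> (T ` I) \<subseteq> topspace X"
      using clo closedin_subset by blast
    fix x assume "x \<in> topspace X"
    then obtain V where V: "openin X V" "x \<in> V" "finite {i \<in> I. T i \<inter> V \<noteq> {}}"
      using fin by blast
    have "{U \<in> T ` I. U \<inter> V \<noteq> {}} = T ` {i \<in> I. T i \<inter> V \<noteq> {}}"
      by blast
    then have "finite {U \<in> T ` I. U \<inter> V \<noteq> {}}"
      using V(3) by (simp only: finite_imageI)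
    then show "\<exists>V. openin X V \<and> x \<in> V \<and> finite {U \<in> T ` I. U \<inter> V \<noteq> {}}"
      using V(1,2) by blast
  qed
  then show closed: "closedin X (\<Union>i\<in>I. T i)"
    using clo by (intro closedin_locally_finite_Union) auto
  let ?S = "\<Union>i\<in>I. T i"
  show "continuous_map (subtopology X ?S) Y f"
  proof (rule pasting_lemma_locally_finite[where I = I and T = T and f = "\<lambda>_. f"])
    fix x assume "x \<in> topspace (subtopology X ?S)"
    then have x: "x \<in> topspace X" "x \<in> ?S"
      by auto
    then obtain V where V: "openin X V" "x \<in> V" "finite {i \<in> I. T i \<inter> V \<noteq> {}}"
      using fin by blast
    have "finite {i \<in> I. T i \<inter> (?S \<inter> V) \<noteq> {}}"
      by (rule finite_subset[OF _ V(3)]) auto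
    then show "\<exists>V. openin (subtopology X ?S) V \<and> x \<in> V \<and> finite {i \<in> I. T i \<inter> V \<noteq> {}}"
      using V x by (intro exI[of _ "?S \<inter> V"]) (auto intro: openin_subtopology_Int2)
  next
    fix i assume i: "i \<in> I"
    show "closedin (subtopology X ?S) (T i)"
      using i clo by (meson UN_upper closedin_subset_topspace)
    have "?S \<inter> T i = T i"
      using i by blast
    then show "continuous_map (subtopology (subtopology X ?S) (T i)) Y f"
      using cont[OF i] by (simp add: subtopology_subtopology)
  qed auto
qed

text \<open>Take for \<open>u x\<close> the first member of \<open>\<U>\<close> containing
  \<open>x\<close> in a well-ordering of all sets. If \<open>y \<in> u x\<close> and
  \<open>x \<in> u y\<close>, then neither of \<open>u x\<close> and \<open>u y\<close> can precede
  the other. Such a selection is the usual start of proofs that metrizable spaces are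
  paracompact.\<close>

lemma least_index_function:
  obtains u :: "'a \<Rightarrow> 'a set" where
    "\<And>x. x \<in> \<Union>\<U> \<Longrightarrow> u x \<in> \<U> \<and> x \<in> u x"
    "\<And>x y. x \<in> \<Union>\<U> \<Longrightarrow> y \<in> \<Union>\<U> \<Longrightarrow> y \<in> u x \<Longrightarrow> x \<in> u y \<Longrightarrow> u x = u y"
proof -
  obtain r :: "'a set rel" where r: "Well_order r" "Field r = UNIV"
    using well_ordering[where 'a = "'a set"] by auto
  then have wf: "wf (r - Id)" and tot: "\<And>A B. A \<noteq> B \<Longrightarrow> (A, B) \<in> r \<or> (B, A) \<in> r"
    by (auto simp: well_order_on_def linear_order_on_def total_on_def)
  have "\<exists>U. (U \<in> \<U> \<and> x \<in> U) \<and> (\<forall>V. (V, U) \<in> r - Id \<longrightarrow> \<not> (V \<in> \<U> \<and> x \<in> V))"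
    if x: "x \<in> \<Union>\<U>" for x
  proof -
    obtain U0 where "U0 \<in> {U \<in> \<U>. x \<in> U}"
      using x by blast
    from wfE_min[OF wf this] obtain U where "U \<in> {U \<in> \<U>. x \<in> U}"
      "\<And>V. (V, U) \<in> r - Id \<Longrightarrow> V \<notin> {U \<in> \<U>. x \<in> U}"
      by metis
    then show ?thesis
      by (intro exI[of _ U]) simp
  qed
  then obtain u where u: "\<And>x. x \<in> \<Union>\<U> \<Longrightarrow> u x \<in> \<U> \<and> x \<in> u x"
    "\<And>x V. x \<in> \<Union>\<U> \<Longrightarrow> (V, u x) \<in> r - Id \<Longrightarrow> \<not> (V \<in> \<U> \<and> x \<in> V)"
    by metis
  show ?thesis
  proof (rule that)
    fix x y assume *: "x \<in> \<Union>\<U>" "y \<in> \<Union>\<U>" "y \<in> u x" "x \<in> u y"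
    show "u x = u y"
    proof (rule ccontr)
      assume "u x \<noteq> u y"
      then have "(u x, u y) \<in> r - Id \<or> (u y, u x) \<in> r - Id"
        using tot by blast
      then show False
        using u * by blast
    qed
  qed (use u in auto)
qed

section \<open>Localization of piecewise continuity in metric spaces\<close>

context Metric_space
begin

text \<open>Since \<open>\<U>\<close> may be uncountable, its pieces have to be merged. Points of
  \<open>A n U\<close> select \<open>U\<close> and lie \<open>1 / Suc n\<close> deep inside it; for
  fixed \<open>n\<close> and \<open>m\<close> the sets \<open>T n m U\<close> are locally finite and
  merge into one closed piece, so countably many pieces remain.\<close>

lemma closed_cover_continuous_Union_open:
  assumes op: "\<And>U. U \<in> \<U> \<Longrightarrow> openin mtopology U"
    and pc: "\<And>U. U \<in> \<U> \<Longrightarrow> closed_cover_continuous mtopology Y f U"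
  shows "closed_cover_continuous mtopology Y f (\<Union>\<U>)"
proof -
  obtain u where u: "\<And>x. x \<in> \<Union>\<U> \<Longrightarrow> u x \<in> \<U> \<and> x \<in> u x"
    and ueq: "\<And>x y. x \<in> \<Union>\<U> \<Longrightarrow> y \<in> \<Union>\<U> \<Longrightarrow> y \<in> u x \<Longrightarrow> x \<in> u y \<Longrightarrow> u x = u y"
    using least_index_function[of \<U>] by blast
  obtain F :: "'a set \<Rightarrow> nat \<Rightarrow> 'a set"
    where F: "\<And>U m. U \<in> \<U> \<Longrightarrow> closedin mtopology (F U m)"
      "\<And>U m. U \<in> \<U> \<Longrightarrow> continuous_map (subtopology mtopology (F U m)) Y f"
      "\<And>U. U \<in> \<U> \<Longrightarrow> U \<subseteq> (\<Union>m. F U m)"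
    using pc unfolding closed_cover_continuous_def by metis
  define A where "A n U = {x \<in> \<Union>\<U>. u x = U \<and> mball x (1 / real (Suc n)) \<subseteq> U}" for n U
  define T where "T n m U = mtopology closure_of A n U \<inter> F U m" for n m U
  have clo: "closedin mtopology (T n m U)" if "U \<in> \<U>" for n m U
    using that F(1) by (auto simp: T_def)
  have cont: "continuous_map (subtopology mtopology (T n m U)) Y f" if "U \<in> \<U>" for n m U
    using F(2)[OF that] by (rule continuous_map_from_subtopology_mono) (auto simp: T_def)
  \<comment> \<open>For fixed \<open>n\<close> the sets \<open>A n U\<close> are pairwise at distance at least \<open>1 / Suc n\<close>.\<close>
  have fin: "\<exists>V. openin mtopology V \<and> x \<in> V \<and> finite {U \<in> \<U>. T n m U \<inter> V \<noteq> {}}"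
    if x: "x \<in> topspace mtopology" for x n m
  proof (intro exI conjI)
    \<comment> \<open>The radius is half the separation of the sets \<open>A n U\<close>, and an
      open ball that meets the closure of \<open>A n U\<close> meets \<open>A n U\<close> itself. So
      \<open>?V\<close> meets \<open>T n m U\<close> for at most one \<open>U\<close>.\<close>
    let ?V = "mball x (1 / (2 * real (Suc n)))"
    show "openin mtopology ?V" "x \<in> ?V"
      using x by auto
    have uniq: "U = U'" if UU: "U \<in> \<U>" "U' \<in> \<U>" "T n m U \<inter> ?V \<noteq> {}" "T n m U' \<inter> ?V \<noteq> {}" for U U'
    proof -
      have "A n U \<inter> ?V \<noteq> {}" "A n U' \<inter> ?V \<noteq> {}"
        using UU openin_Int_closure_of_eq_empty[OF openin_mball[of x "1 / (2 * real (Suc n))"]]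
        unfolding T_def by blast+
      then obtain y z where yz: "y \<in> A n U" "y \<in> ?V" "z \<in> A n U'" "z \<in> ?V"
        by blast
      have "d y z \<le> d x y + d x z"
        using yz x by (simp add: triangle'')
      also have "\<dots> < 1 / (2 * real (Suc n)) + 1 / (2 * real (Suc n))"
        using yz by (intro add_strict_mono) auto
      also have "\<dots> = 1 / real (Suc n)"
        by (simp add: field_simps)
      finally have "z \<in> mball y (1 / real (Suc n))" "y \<in> mball z (1 / real (Suc n))"
        using yz by (auto simp: commute)
      then show ?thesis
        using yz ueq[of y z] unfolding A_def by blast
    qed
    show "finite {U \<in> \<U>. T n m U \<inter> ?V \<noteq> {}}"
    proof (cases "{U \<in> \<U>. T n m U \<inter> ?V \<noteq> {}} = {}")
      case False
      then obtain U where "U \<in> \<U>" "T n m U \<inter> ?V \<noteq> {}"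
        by blast
      then have "{U \<in> \<U>. T n m U \<inter> ?V \<noteq> {}} \<subseteq> {U}"
        using uniq by blast
      then show ?thesis
        using finite_subset by blast
    qed (simp only: finite.emptyI)
  qed
  have "closed_cover_continuous mtopology Y f (\<Union>U\<in>\<U>. T n m U)" for n m
    using locally_finite_closed_pieces[where X = mtopology and I = \<U> and T = "T n m" and f = f and Y = Y,
        OF fin clo cont]
    by (intro closed_cover_continuous_piece) auto
  then have "closed_cover_continuous mtopology Y f (\<Union>n. \<Union>m. \<Union>U\<in>\<U>. T n m U)"
    by (intro closed_cover_continuous_UN)
  then show ?thesis
  proof (rule closed_cover_continuous_subset)
    show "\<Union>\<U> \<subseteq> (\<Union>n. \<Union>m. \<Union>U\<in>\<U>. T n m U)"
    proof
      fix x assume x: "x \<in> \<Union>\<U>"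
      then have ux: "u x \<in> \<U>" "x \<in> u x"
        using u by auto
      then obtain e where e: "e > 0" "mball x e \<subseteq> u x"
        using op[OF ux(1)] unfolding openin_mtopology by blast
      obtain n where "1 / real (Suc n) < e"
        using nat_approx_posE[OF e(1)] by (auto simp: of_nat_Suc)
      then have "mball x (1 / real (Suc n)) \<subseteq> u x"
        using e(2) mball_subset_concentric[of "1 / real (Suc n)" e x] by auto
      then have "x \<in> A n (u x)"
        using x by (simp add: A_def)
      moreover have "A n (u x) \<subseteq> M"
        using op[THEN openin_subset] by (auto simp: A_def)
      ultimately have "x \<in> mtopology closure_of A n (u x)"
        using closure_of_subset[of "A n (u x)" mtopology] by auto
      moreover obtain m where "x \<in> F (u x) m"
        using F(3)[OF ux(1)] ux(2) by blast
      ultimately have "x \<in> T n m (u x)"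
        by (simp add: T_def)
      then show "x \<in> (\<Union>n. \<Union>m. \<Union>U\<in>\<U>. T n m U)"
        using ux(1) by blast
    qed
  qed
qed

text \<open>Remove from the space all open sets that have a countable cover by closed pieces of
  continuity. Were \<open>f\<close> continuous on a nonempty \<open>U \<inter> X'\<close>, then
  \<open>U\<close> would have such a cover too and would have been removed.\<close>

lemma not_piecewise_continuous_kernel:
  assumes npc: "\<not> piecewise_continuous_map mtopology Y f"
  obtains X' where "closedin mtopology X'" "X' \<noteq> {}"
    "\<And>U. openin mtopology U \<Longrightarrow> U \<inter> X' \<noteq> {} \<Longrightarrow> \<not> continuous_map (subtopology mtopology (U \<inter> X')) Y f"
proof -
  define \<U> where "\<U> = {U. openin mtopology U \<and> closed_cover_continuous mtopology Y f U}"
  have W: "closed_cover_continuous mtopology Y f (\<Union>\<U>)"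
    by (rule closed_cover_continuous_Union_open) (auto simp: \<U>_def)
  have "openin mtopology (\<Union>\<U>)"
    by (auto simp: \<U>_def)
  then have clo: "closedin mtopology (M - \<Union>\<U>)"
    by (metis closedin_def Diff_subset double_diff openin_subset order_refl topspace_mtopology)
  show ?thesis
  proof (rule that[OF clo])
    show "M - \<Union>\<U> \<noteq> {}"
      using npc W by (metis Diff_eq_empty_iff closed_cover_continuous_subset piecewise_continuous_map_iff topspace_mtopology)
    fix U assume U: "openin mtopology U" "U \<inter> (M - \<Union>\<U>) \<noteq> {}"
    show "\<not> continuous_map (subtopology mtopology (U \<inter> (M - \<Union>\<U>))) Y f"
    proof
      assume cont: "continuous_map (subtopology mtopology (U \<inter> (M - \<Union>\<U>))) Y f"
      \<comment> \<open>The set \<open>U \<inter> (M - \<Union>\<U>)\<close> need not be closed, but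
        the open set \<open>U\<close> is an F-sigma set in a metrizable space, which cuts the
        intersection into countably many closed pieces.\<close>
      obtain E :: "nat \<Rightarrow> 'a set" where E: "\<And>n. closedin mtopology (E n)" "\<Union>(range E) = U"
        using open_imp_fsigma_in[OF metrizable_space_mtopology U(1)]
        unfolding fsigma_in_ascending by blast
      have "closed_cover_continuous mtopology Y f (E n \<inter> (M - \<Union>\<U>))" for n
        using E clo
        by (intro closed_cover_continuous_piece closedin_Int continuous_map_from_subtopology_mono[OF cont]) auto
      then have "closed_cover_continuous mtopology Y f (\<Union>\<U> \<union> (\<Union>n. E n \<inter> (M - \<Union>\<U>)))"
        by (intro closed_cover_continuous_Un W closed_cover_continuous_UN)
      moreover have "U \<subseteq> \<Union>\<U> \<union> (\<Union>n. E n \<inter> (M - \<Union>\<U>))"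
        using E(2) openin_subset[OF U(1)] by auto
      ultimately have "U \<in> \<U>"
        using U(1) closed_cover_continuous_subset unfolding \<U>_def by blast
      then show False
        using U(2) by blast
    qed
  qed
qed

end

section \<open>Restriction to the set of discontinuity points\<close>

text \<open>Regularity separates \<open>f x\<close> from the values outside a neighbourhood
  \<open>V\<close> that witnesses the discontinuity at \<open>x\<close>. A point near
  \<open>x\<close> with value outside \<open>V\<close>, if not itself in \<open>D\<close>, is a
  continuity point, so points of the dense set \<open>D\<close> close to it also have values away
  from \<open>f x\<close>.\<close>

lemma not_topcontinuous_at_discontinuity_set:
  assumes reg: "regular_space Y"
    and f: "f \<in> topspace X \<rightarrow> topspace Y"
    and D: "D = {x \<in> topspace X. \<not> topcontinuous_at X Y f x}"
    and dense: "X closure_of D = topspace X"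
    and x: "x \<in> D"
  shows "\<not> topcontinuous_at (subtopology X D) Y f x"
proof
  assume cx: "topcontinuous_at (subtopology X D) Y f x"
  obtain V where V: "openin Y V" "f x \<in> V" "\<And>W. openin X W \<Longrightarrow> x \<in> W \<Longrightarrow> \<exists>y\<in>W. f y \<notin> V"
  proof -
    have "x \<in> topspace X" "\<not> topcontinuous_at X Y f x"
      using x unfolding D by auto
    then show ?thesis
      using f that unfolding topcontinuous_at_def by metis
  qed
  have "closedin Y (topspace Y - V)" "f x \<in> topspace Y - (topspace Y - V)"
    using V(1,2) openin_subset by fastforce+
  then obtain V' G where V': "openin Y V'" "openin Y G" "f x \<in> V'" "topspace Y - V \<subseteq> G" "disjnt V' G"
    using reg unfolding regular_space_def by meson
  obtain O' where O': "openin (subtopology X D) O'" "x \<in> O'" "\<forall>y\<in>O'. f y \<in> V'"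
    using cx V'(1,3) unfolding topcontinuous_at_def by blast
  then obtain P where P: "openin X P" "O' = P \<inter> D"
    by (auto simp: openin_subtopology)
  then obtain c where c: "c \<in> P" "f c \<notin> V"
    using V(3)[of P] O'(2) by blast
  have cX: "c \<in> topspace X"
    using c(1) P(1) openin_subset by blast
  then have cG: "f c \<in> G"
    using f c(2) V'(4) by blast
  \<comment> \<open>On \<open>P \<inter> D\<close> the values lie in \<open>V'\<close>, which is
    disjoint from \<open>G\<close>. Thus \<open>f\<close> is continuous at \<open>c\<close>, and the
    resulting neighbourhood \<open>Q\<close> with values in \<open>G\<close> will meet
    \<open>P \<inter> D\<close>, a contradiction.\<close>
  then have "c \<notin> D"
    using O'(3) P(2) c(1) V'(5) unfolding disjnt_iff by blast
  then obtain Q where Q: "openin X Q" "c \<in> Q" "\<forall>y\<in>Q. f y \<in> G"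
    using cX cG V'(2) unfolding D topcontinuous_at_def by blast
  have "c \<in> X closure_of D" "openin X (P \<inter> Q)"
    using dense cX P Q by auto
  then obtain e where "e \<in> D" "e \<in> P \<inter> Q"
    using c(1) Q(2) unfolding in_closure_of by blast
  then show False
    using O'(3) P(2) Q(3) V'(5) unfolding disjnt_iff by blast
qed

section \<open>A countable nowhere continuous restriction with zero-dimensional closure\<close>

context Metric_space
begin

lemma finite_separation:
  assumes "finite S" "S \<subseteq> M"
  obtains r where "r > 0" "\<And>x y. x \<in> S \<Longrightarrow> y \<in> S \<Longrightarrow> x \<noteq> y \<Longrightarrow> 2 * r \<le> d x y"
proof -
  \<comment> \<open>The element \<open>1\<close> keeps the minimum meaningful when \<open>S\<close>
    has at most one point.\<close>
  let ?E = "insert 1 ((\<lambda>(x, y). d x y / 2) ` {(x, y) \<in> S \<times> S. x \<noteq> y})"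
  have "finite {(x, y) \<in> S \<times> S. x \<noteq> y}"
    by (rule finite_subset[of _ "S \<times> S"]) (use assms(1) in auto)
  then have fin: "finite ?E"
    by (simp only: finite_insert finite_imageI)
  show ?thesis
  proof (rule that[of "Min ?E"])
    have "d x y > 0" if "x \<in> S" "y \<in> S" "x \<noteq> y" for x y
      using that assms(2) by (simp add: mdist_pos_less subset_iff)
    then show "Min ?E > 0"
      using fin by (subst Min_gr_iff) auto
    fix x y assume "x \<in> S" "y \<in> S" "x \<noteq> y"
    then have "Min ?E \<le> d x y / 2"
      by (intro Min_le[OF fin]) force
    then show "2 * Min ?E \<le> d x y"
      by simp
  qed
qed

text \<open>Finite sets \<open>S n\<close> grow to \<open>N\<close>: each stage adds, very close to
  every point present, a point violating continuity there. Since old points stay, each is violated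
  at arbitrarily small scales. The new points are so close that, for every \<open>n\<close>, the
  closure of \<open>N\<close> splits into finitely many clopen parts around the points of
  \<open>S n\<close>.\<close>

lemma nowhere_continuous_countable_subset:
  assumes Z: "Z \<subseteq> M" "Z \<noteq> {}" and f: "f \<in> M \<rightarrow> topspace Y"
    and disc: "\<And>z. z \<in> Z \<Longrightarrow> \<not> topcontinuous_at (subtopology mtopology Z) Y f z"
  obtains N where "countable N" "N \<subseteq> Z" "N \<noteq> {}"
    "zero_dimensional_space (subtopology mtopology (mtopology closure_of N))"
    "\<And>z. z \<in> N \<Longrightarrow> \<not> topcontinuous_at (subtopology mtopology N) Y f z"
proof -
  \<comment> \<open>The neighbourhood is fixed before the scale \<open>e\<close>, so that witnesses
    found at different stages all violate continuity at \<open>z\<close> for the same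
    \<open>V z\<close>.\<close>
  have "\<exists>V. openin Y V \<and> f z \<in> V \<and> (\<forall>e>0. \<exists>y\<in>Z. d z y < e \<and> f y \<notin> V)" if z: "z \<in> Z" for z
  proof -
    obtain V where V: "openin Y V" "f z \<in> V"
      "\<And>W. openin (subtopology mtopology Z) W \<Longrightarrow> z \<in> W \<Longrightarrow> \<exists>y\<in>W. f y \<notin> V"
      using disc[OF z] f z Z(1) unfolding topcontinuous_at_def by auto
    have "\<exists>y\<in>Z. d z y < e \<and> f y \<notin> V" if "e > 0" for e
    proof -
      have "openin (subtopology mtopology Z) (Z \<inter> mball z e)"
        by (simp add: openin_subtopology_Int2)
      then show ?thesis
        using V(3)[of "Z \<inter> mball z e"] z Z(1) \<open>e > 0\<close> by force
    qed
    then show ?thesis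
      using V by blast
  qed
  then obtain V where V: "\<And>z. z \<in> Z \<Longrightarrow> openin Y (V z)" "\<And>z. z \<in> Z \<Longrightarrow> f z \<in> V z"
    "\<And>z e. z \<in> Z \<Longrightarrow> e > 0 \<Longrightarrow> \<exists>y\<in>Z. d z y < e \<and> f y \<notin> V z"
    by metis
  then obtain w where w: "\<And>z e. z \<in> Z \<Longrightarrow> e > 0 \<Longrightarrow> w z e \<in> Z \<and> d z (w z e) < e \<and> f (w z e) \<notin> V z"
    by metis
  \<comment> \<open>A stage is a finite set with a radius. The bound \<open>(1/4)^n\<close> drives
    the radii to 0, and the factor 2 makes the open balls of that radius around the points
    disjoint.\<close>
  define P where "P n p \<longleftrightarrow> finite (fst p) \<and> fst p \<noteq> {} \<and> fst p \<subseteq> Z \<and> 0 < snd p \<and> snd p \<le> (1/4)^n \<and>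
      (\<forall>x\<in>fst p. \<forall>y\<in>fst p. x \<noteq> y \<longrightarrow> 2 * snd p \<le> d x y)" for n :: nat and p :: "'a set \<times> real"
  \<comment> \<open>Moves by a quarter of a radius that shrinks at least fourfold at each stage add
    up to at most a third of the initial radius, so all later points stay within half a radius of
    the current stage.\<close>
  define Q where "Q p q \<longleftrightarrow> fst p \<subseteq> fst q \<and> snd q \<le> snd p / 4 \<and>
      (\<forall>z\<in>fst p. \<exists>y\<in>fst q. d z y \<le> snd p / 4 \<and> f y \<notin> V z) \<and>
      (\<forall>y\<in>fst q. \<exists>z\<in>fst p. d z y \<le> snd p / 4)" for p q :: "'a set \<times> real"
  have "\<exists>g. \<forall>n. P n (g n) \<and> Q (g n) (g (Suc n))"
  proof (rule dependent_nat_choice)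
    obtain z where "z \<in> Z"
      using Z(2) by blast
    then show "\<exists>p. P 0 p"
      unfolding P_def by (intro exI[of _ "({z}, 1)"]) simp
  next
    fix p n assume p: "P n p"
    define S' where "S' = fst p \<union> (\<lambda>z. w z (snd p / 4)) ` fst p"
    have ww: "w z (snd p / 4) \<in> Z \<and> d z (w z (snd p / 4)) < snd p / 4 \<and> f (w z (snd p / 4)) \<notin> V z"
      if "z \<in> fst p" for z
      using p that by (intro w) (auto simp: P_def)
    have S': "finite S'" "S' \<noteq> {}" "S' \<subseteq> Z"
      using p ww by (auto simp: S'_def P_def)
    obtain s where s: "s > 0" "\<And>x y. x \<in> S' \<Longrightarrow> y \<in> S' \<Longrightarrow> x \<noteq> y \<Longrightarrow> 2 * s \<le> d x y"
      using finite_separation[OF S'(1) order_trans[OF S'(3) Z(1)]] by blast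
    \<comment> \<open>The term \<open>s\<close> separates the enlarged set \<open>S'\<close>, and
      \<open>snd p / 4\<close> enforces the decay of the radii.\<close>
    define s' where "s' = min s (snd p / 4)"
    have p': "0 < snd p" "snd p \<le> (1/4)^n"
      using p by (auto simp: P_def)
    have "2 * s' \<le> d x y" if "x \<in> S'" "y \<in> S'" "x \<noteq> y" for x y
      using s(2)[OF that] by (simp add: s'_def)
    moreover have "0 < s'" "s' \<le> (1/4)^Suc n"
      using p' s(1) by (auto simp: s'_def)
    ultimately have "P (Suc n) (S', s')"
      using S' by (simp add: P_def)
    moreover have "Q p (S', s')"
      unfolding Q_def
    proof (intro conjI ballI)
      show "fst p \<subseteq> fst (S', s')" "snd (S', s') \<le> snd p / 4"
        by (auto simp: S'_def s'_def)
      fix z assume "z \<in> fst p"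
      then show "\<exists>y\<in>fst (S', s'). d z y \<le> snd p / 4 \<and> f y \<notin> V z"
        using ww[of z] by (intro bexI[of _ "w z (snd p / 4)"]) (auto simp: S'_def)
    next
      fix y assume "y \<in> fst (S', s')"
      then consider "y \<in> fst p" | z where "z \<in> fst p" "y = w z (snd p / 4)"
        by (auto simp: S'_def)
      then show "\<exists>z\<in>fst p. d z y \<le> snd p / 4"
      proof cases
        case 1
        then have "y \<in> M" "0 < snd p"
          using p Z(1) by (auto simp: P_def)
        then show ?thesis
          using 1 by (intro bexI[of _ y]) auto
      next
        case 2
        then show ?thesis
          using ww[of z] by (intro bexI[of _ z]) auto
      qed
    qed
    ultimately show "\<exists>q. P (Suc n) q \<and> Q p q"
      by blast
  qed
  then obtain g where g: "\<And>n. P n (g n)" "\<And>n. Q (g n) (g (Suc n))"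
    by blast
  define S where "S n = fst (g n)" for n
  define r where "r n = snd (g n)" for n
  have S: "finite (S n)" "S n \<noteq> {}" "S n \<subseteq> Z" and r: "0 < r n" "r n \<le> (1/4)^n" for n
    using g(1)[of n] by (auto simp: P_def S_def r_def)
  have sep: "2 * r n \<le> d x y" if "x \<in> S n" "y \<in> S n" "x \<noteq> y" for n x y
    using g(1)[of n] that by (auto simp: P_def S_def r_def)
  have Smono: "S n \<subseteq> S (Suc n)" and rSuc: "r (Suc n) \<le> r n / 4" for n
    using g(2)[of n] by (auto simp: Q_def S_def r_def)
  have wit: "\<exists>y\<in>S (Suc n). d z y \<le> r n / 4 \<and> f y \<notin> V z" if "z \<in> S n" for n z
    using g(2)[of n] that by (auto simp: Q_def S_def r_def)
  have near1: "\<exists>z\<in>S n. d z y \<le> r n / 4" if "y \<in> S (Suc n)" for n y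
    using g(2)[of n] that by (auto simp: Q_def S_def r_def)
  have SM: "S n \<subseteq> M" for n
    using S(3) Z(1) by blast
  have Smono': "S n \<subseteq> S m" if "n \<le> m" for n m
    using that Smono by (rule lift_Suc_mono_le[rotated])
  \<comment> \<open>The induction peels off the first move: \<open>z\<close> is within
    \<open>r (Suc n) / 2 \<le> r n / 8\<close> of \<open>S (Suc n)\<close>, and a move of at most
    \<open>r n / 4\<close> leads to \<open>S n\<close>.\<close>
  have near: "\<exists>y\<in>S n. d y z \<le> r n / 2" if "z \<in> S (n + m)" for n m z
    using that
  proof (induction m arbitrary: n)
    case 0
    then have "z \<in> S n" "z \<in> M"
      using SM by auto
    then show ?case
      using r(1)[of n] by (intro bexI[of _ z]) auto
  next
    case (Suc m)
    then obtain y' where y': "y' \<in> S (Suc n)" "d y' z \<le> r (Suc n) / 2"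
      by (metis add_Suc_shift)
    obtain y where y: "y \<in> S n" "d y y' \<le> r n / 4"
      using near1[OF y'(1)] by blast
    have "d y z \<le> d y y' + d y' z"
      using y y' Suc.prems SM by (intro triangle) auto
    also have "\<dots> \<le> r n / 4 + r n / 8"
      using y(2) y'(2) rSuc[of n] by linarith
    also have "\<dots> \<le> r n / 2"
      using r(1)[of n] by simp
    finally show ?case
      using y(1) by blast
  qed
  define N where "N = (\<Union>n. S n)"
  define K where "K = mtopology closure_of N"
  have NM: "N \<subseteq> M"
    using SM by (auto simp: N_def)
  have Ncov: "N \<subseteq> (\<Union>y\<in>S n. mcball y (r n / 2))" for n
  proof
    fix z assume z: "z \<in> N"
    then obtain k where "z \<in> S k"
      by (auto simp: N_def)
    then have "z \<in> S (n + k)"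
      using Smono'[of k "n + k"] by auto
    then show "z \<in> (\<Union>y\<in>S n. mcball y (r n / 2))"
      using near[of z n k] z NM SM by fastforce
  qed
  \<comment> \<open>As \<open>S n\<close> is finite, the union of the closed balls is closed, so the
    cover of \<open>N\<close> also covers its closure.\<close>
  have Kcov: "K \<subseteq> (\<Union>y\<in>S n. mcball y (r n / 2))" for n
    unfolding K_def using S(1) by (intro closure_of_minimal[OF Ncov] closedin_Union) auto
  have KM: "K \<subseteq> M"
    unfolding K_def using closure_of_subset_topspace[of mtopology N] by simp
  \<comment> \<open>No point of \<open>K\<close> lies between the two radii: it would be in the
    half-radius ball of another point of \<open>S n\<close>, contrary to the separation
    \<open>2 * r n\<close>. Hence the trace of the ball on \<open>K\<close> is both open and
    closed.\<close>
  have ball_eq: "K \<inter> mball y (r n) = K \<inter> mcball y (r n / 2)" if y: "y \<in> S n" for n y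
  proof (intro equalityI subsetI)
    fix x assume x: "x \<in> K \<inter> mball y (r n)"
    then obtain y' where y': "y' \<in> S n" "x \<in> mcball y' (r n / 2)"
      using Kcov[of n] by blast
    have "d y y' \<le> d y x + d y' x"
      using x y y' by (intro triangle') auto
    also have "\<dots> < 2 * r n"
      using x y' r(1)[of n] by auto
    finally have "y = y'"
      using sep[OF y y'(1)] by fastforce
    then show "x \<in> K \<inter> mcball y (r n / 2)"
      using x y' by blast
  next
    fix x assume "x \<in> K \<inter> mcball y (r n / 2)"
    then show "x \<in> K \<inter> mball y (r n)"
      using r(1)[of n] by auto
  qed
  have "subtopology mtopology K dim_le 0"
    unfolding dimension_le_0_neighbourhood_base_of_clopen neighbourhood_base_of
  proof (intro allI impI)
    fix W x assume W: "openin (subtopology mtopology K) W \<and> x \<in> W"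
    then obtain W' where W': "openin mtopology W'" "W = W' \<inter> K"
      by (auto simp: openin_subtopology)
    then obtain e where e: "e > 0" "mball x e \<subseteq> W'"
      using W unfolding openin_mtopology by blast
    obtain n where "(1/4 :: real)^n < e"
      using real_arch_pow_inv[of e "1/4"] e(1) by auto
    then have rn: "r n < e"
      using r(2)[of n] by linarith
    have xK: "x \<in> K"
      using W W' by blast
    then obtain y where y: "y \<in> S n" "x \<in> mcball y (r n / 2)"
      using Kcov[of n] by blast
    let ?B = "K \<inter> mcball y (r n / 2)"
    have "openin (subtopology mtopology K) ?B"
      unfolding ball_eq[OF y(1), symmetric] by (simp add: openin_subtopology_Int2)
    moreover have "closedin (subtopology mtopology K) ?B"
      by (simp add: closedin_subtopology_Int_closed)
    moreover have "?B \<subseteq> W"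
    proof
      fix z assume z: "z \<in> ?B"
      have "d x z \<le> d y x + d y z"
        using y z by (intro triangle'') auto
      also have "\<dots> < e"
        using y z rn by auto
      finally have "z \<in> mball x e"
        using y z by auto
      then show "z \<in> W"
        using e z W' by blast
    qed
    ultimately show "\<exists>U V. openin (subtopology mtopology K) U \<and>
        (closedin (subtopology mtopology K) V \<and> openin (subtopology mtopology K) V) \<and>
        x \<in> U \<and> U \<subseteq> V \<and> V \<subseteq> W"
      using xK y(2) by (intro exI[of _ ?B]) auto
  qed
  then have zd: "zero_dimensional_space (subtopology mtopology K)"
    by (simp add: zero_dimensional_space_iff_dim_le_0)
  have ndisc: "\<not> topcontinuous_at (subtopology mtopology N) Y f z" if z: "z \<in> N" for z
  proof
    assume cz: "topcontinuous_at (subtopology mtopology N) Y f z"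
    obtain k where k: "z \<in> S k"
      using z by (auto simp: N_def)
    then have zZ: "z \<in> Z"
      using S(3) by blast
    obtain O' where O': "openin (subtopology mtopology N) O'" "z \<in> O'" "\<forall>y\<in>O'. f y \<in> V z"
      using cz V(1,2)[OF zZ] unfolding topcontinuous_at_def by blast
    then obtain W' where W': "openin mtopology W'" "O' = W' \<inter> N"
      by (auto simp: openin_subtopology)
    then obtain e where e: "e > 0" "mball z e \<subseteq> W'"
      using O'(2) unfolding openin_mtopology by blast
    obtain n where n: "(1/4 :: real)^n < e"
      using real_arch_pow_inv[of e "1/4"] e(1) by auto
    \<comment> \<open>From stage \<open>k\<close> on \<open>z\<close> is present, and from stage
      \<open>n\<close> on the radius is below \<open>e\<close>.\<close>
    let ?m = "max n k"
    have "(1/4 :: real)^?m \<le> (1/4)^n"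
      by (intro power_decreasing) auto
    then have rm: "r ?m < e"
      using r(2)[of ?m] n by linarith
    have "z \<in> S ?m"
      using k Smono'[of k ?m] by auto
    then obtain y where y: "y \<in> S (Suc ?m)" "d z y \<le> r ?m / 4" "f y \<notin> V z"
      using wit by blast
    then have "y \<in> mball z e"
      using rm r(1)[of ?m] z NM SM[of "Suc ?m"] by auto
    then have "y \<in> O'"
      using e(2) W'(2) y(1) by (auto simp: N_def)
    then show False
      using O'(3) y(3) by blast
  qed
  show ?thesis
  proof (rule that[of N])
    show "countable N"
      using S(1) by (auto simp: N_def intro: countable_finite)
    show "N \<subseteq> Z" "N \<noteq> {}"
      using S(2,3) by (auto simp: N_def)
  qed (use zd ndisc in \<open>auto simp: K_def\<close>)
qed

end

section \<open>The Baire category argument\<close>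

text \<open>Only the part of \<open>N\<close> near \<open>z\<close> has to lie in \<open>C\<close>:
  cutting a neighbourhood down by \<open>P\<close> transfers continuity from \<open>C\<close> to
  \<open>N\<close>.\<close>

lemma topcontinuous_at_continuous_map_piece:
  assumes cont: "continuous_map (subtopology X C) Y f"
    and N: "N \<subseteq> topspace X" "f \<in> N \<rightarrow> topspace Y"
    and P: "openin X P" "P \<inter> N \<subseteq> C" and z: "z \<in> P \<inter> N"
  shows "topcontinuous_at (subtopology X N) Y f z"
proof -
  have zC: "topcontinuous_at (subtopology X C) Y f z"
    using cont z P(2) N(1) by (auto simp: continuous_map_eq_topcontinuous_at)
  show ?thesis
    unfolding topcontinuous_at_def
  proof (intro conjI allI impI)
    show "z \<in> topspace (subtopology X N)" "f \<in> topspace (subtopology X N) \<rightarrow> topspace Y"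
      using z N by auto
    fix V assume "openin Y V \<and> f z \<in> V"
    then obtain O' where O': "openin (subtopology X C) O'" "z \<in> O'" "\<forall>y\<in>O'. f y \<in> V"
      using zC unfolding topcontinuous_at_def by blast
    then obtain R where R: "openin X R" "O' = R \<inter> C"
      by (auto simp: openin_subtopology)
    have "openin (subtopology X N) (N \<inter> (P \<inter> R))"
      using P(1) R(1) by (intro openin_subtopology_Int2 openin_Int)
    then show "\<exists>U. openin (subtopology X N) U \<and> z \<in> U \<and> (\<forall>y\<in>U. f y \<in> V)"
      using O' R z P(2) by (intro exI[of _ "N \<inter> (P \<inter> R)"]) auto
  qed
qed

text \<open>A closed piece of continuity cannot contain a nonempty relatively open part of the
  closure: that part would meet the dense set \<open>N\<close>, giving a continuity point of the
  restriction to \<open>N\<close>. So the complements of the pieces are dense, and the Baire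
  property yields a point outside all of them.\<close>

lemma Baire_not_piecewise_continuous:
  assumes Baire: "Baire_space (subtopology X (X closure_of N))"
    and N: "N \<subseteq> topspace X" "N \<noteq> {}"
    and disc: "\<And>z. z \<in> N \<Longrightarrow> \<not> topcontinuous_at (subtopology X N) Y f z"
  shows "\<not> piecewise_continuous_map (subtopology X (X closure_of N)) Y f"
proof
  let ?K = "X closure_of N"
  let ?XK = "subtopology X ?K"
  have top: "topspace ?XK = ?K"
    using closure_of_subset_topspace[of X N] by auto
  have NK: "N \<subseteq> ?K"
    using N(1) by (rule closure_of_subset)
  assume "piecewise_continuous_map ?XK Y f"
  then obtain C :: "nat \<Rightarrow> 'a set" where C: "\<And>n. closedin ?XK (C n)" "(\<Union>n. C n) = ?K"
    "\<And>n. continuous_map (subtopology ?XK (C n)) Y f"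
    unfolding piecewise_continuous_map_def top by blast
  have CK: "C n \<subseteq> ?K" for n
    using C(2) by blast
  have fN: "f \<in> N \<rightarrow> topspace Y"
  proof
    fix z assume z: "z \<in> N"
    then obtain n where n: "z \<in> C n"
      using NK C(2) by blast
    then have "z \<in> topspace (subtopology ?XK (C n))"
      using z N(1) NK by auto
    then show "f z \<in> topspace Y"
      using C(3)[of n] unfolding continuous_map_def by blast
  qed
  have "?XK closure_of (?K - C n) = ?K" for n
  proof (rule ccontr)
    assume "?XK closure_of (?K - C n) \<noteq> ?K"
    then obtain x where x: "x \<in> ?K" "x \<notin> ?XK closure_of (?K - C n)"
      using closure_of_subset_topspace[of ?XK "?K - C n"] top by blast
    then obtain T where T: "openin ?XK T" "x \<in> T" "T \<inter> (?K - C n) = {}"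
      unfolding in_closure_of top by blast
    then obtain P where P: "openin X P" "T = P \<inter> ?K"
      by (auto simp: openin_subtopology)
    obtain z where z: "z \<in> N" "z \<in> P"
      using T(2) P x(1) unfolding in_closure_of by blast
    have "continuous_map (subtopology X (C n)) Y f"
      using C(3)[of n] CK[of n] by (simp add: subtopology_subtopology Int_absorb1)
    then have "topcontinuous_at (subtopology X N) Y f z"
      using N(1) fN P(1)
      by (rule topcontinuous_at_continuous_map_piece) (use T(3) P(2) NK z in auto)
    then show False
      using disc z(1) by blast
  qed
  moreover have "openin ?XK (?K - C n)" for n
    using C(1)[of n] top by (metis closedin_def)
  ultimately have "?XK closure_of (?K \<inter> \<Inter>(range (\<lambda>n. ?K - C n))) = ?K"
    using Baire[unfolded Baire_space_def top, rule_format, of "range (\<lambda>n. ?K - C n)"] by simp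
  moreover have "?K \<inter> \<Inter>(range (\<lambda>n. ?K - C n)) = {}"
    using C(2) by blast
  ultimately show False
    using N(2) NK by simp
qed

section \<open>Construction of the closed set \<open>K\<close>\<close>

theorem theorem9:
  fixes X :: "'a topology" and Y :: "'b topology" and f :: "'a \<Rightarrow> 'b"
  assumes "metrizable_space X"
    and "completely_Baire_space X"
    and "regular_space Y"
    and "t1_space Y"
    and "Sigma02_measurable_map X Y f"
    and "\<not> piecewise_continuous_map X Y f"
  shows "\<exists>K. closedin X K \<and>
             zero_dimensional_space (subtopology X K) \<and>
             separable_space (subtopology X K) \<and>
             Sigma02_measurable_map (subtopology X K) Y f \<and>
             \<not> piecewise_continuous_map (subtopology X K) Y f"
proof -
  obtain M d where "Metric_space M d" and X: "X = Metric_space.mtopology M d"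
    using assms(1) unfolding metrizable_space_def by blast
  interpret Metric_space M d
    by fact
  have top: "topspace X = M"
    by (simp add: X)
  have f: "f \<in> M \<rightarrow> topspace Y"
    using assms(5) by (simp add: Sigma02_measurable_map_def top)
  obtain X' where X': "closedin X X'" "X' \<noteq> {}"
    and nc: "\<And>U. openin X U \<Longrightarrow> U \<inter> X' \<noteq> {} \<Longrightarrow> \<not> continuous_map (subtopology X (U \<inter> X')) Y f"
    using not_piecewise_continuous_kernel[of Y f] assms(6) unfolding X by metis
  have X'M: "X' \<subseteq> M"
    using closedin_subset[OF X'(1)] top by simp
  then have top': "topspace (subtopology X X') = X'"
    using top by auto
  define D where "D = {x \<in> topspace (subtopology X X'). \<not> topcontinuous_at (subtopology X X') Y f x}"
  have DX': "D \<subseteq> X'"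
    unfolding D_def top' by blast
  \<comment> \<open>A nonempty relatively open \<open>T\<close> missing \<open>D\<close> would
    consist of continuity points, making \<open>f\<close> continuous on
    \<open>T = P \<inter> X'\<close>, which the choice of \<open>X'\<close> excludes.\<close>
  have dense: "subtopology X X' closure_of D = topspace (subtopology X X')"
  proof (rule ccontr)
    assume "subtopology X X' closure_of D \<noteq> topspace (subtopology X X')"
    then obtain x where x: "x \<in> X'" "x \<notin> subtopology X X' closure_of D"
      using closure_of_subset_topspace[of "subtopology X X'" D] top' by blast
    then obtain T where T: "openin (subtopology X X') T" "x \<in> T" "T \<inter> D = {}"
      unfolding in_closure_of top' by blast
    then obtain P where P: "openin X P" "T = P \<inter> X'"
      by (auto simp: openin_subtopology)
    have "topcontinuous_at (subtopology X T) Y f y" if y: "y \<in> T" for y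
    proof -
      have "topcontinuous_at (subtopology X X') Y f y"
        using y T(3) P(2) top' unfolding D_def by blast
      then have y':
        "\<And>V. openin Y V \<Longrightarrow> f y \<in> V \<Longrightarrow> \<exists>U. openin (subtopology X X') U \<and> y \<in> U \<and> (\<forall>z\<in>U. f z \<in> V)"
        unfolding topcontinuous_at_def by blast
      have "\<exists>U. openin (subtopology X T) U \<and> y \<in> U \<and> (\<forall>z\<in>U. f z \<in> V)" if VY: "openin Y V" "f y \<in> V" for V
      proof -
        obtain U where U: "openin (subtopology X X') U" "y \<in> U" "\<forall>z\<in>U. f z \<in> V"
          using y'[OF VY] by blast
        then obtain R where "openin X R" "U = R \<inter> X'"
          by (auto simp: openin_subtopology)
        then show ?thesis
          using U y P(2) by (intro exI[of _ "T \<inter> R"]) (auto simp: openin_subtopology_Int2)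
      qed
      then show ?thesis
        using y P(2) X'M f top unfolding topcontinuous_at_def by auto
    qed
    then have "continuous_map (subtopology X (P \<inter> X')) Y f"
      unfolding continuous_map_eq_topcontinuous_at P(2) by auto
    then show False
      using nc[OF P(1)] T(2) P(2) by blast
  qed
  have "D \<noteq> {}"
    using dense X'(2) top' by auto
  have fX': "f \<in> topspace (subtopology X X') \<rightarrow> topspace Y"
    using f X'M top' by auto
  have disc: "\<not> topcontinuous_at (subtopology X D) Y f z" if "z \<in> D" for z
  proof -
    have "subtopology (subtopology X X') D = subtopology X D"
      using DX' by (simp add: subtopology_subtopology Int_absorb1)
    then show ?thesis
      using not_topcontinuous_at_discontinuity_set[OF assms(3) fX' D_def dense that] by simp
  qed
  obtain N where N: "countable N" "N \<subseteq> D" "N \<noteq> {}"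
    and zd: "zero_dimensional_space (subtopology X (X closure_of N))"
    and ndisc: "\<And>z. z \<in> N \<Longrightarrow> \<not> topcontinuous_at (subtopology X N) Y f z"
    using nowhere_continuous_countable_subset[of D f Y] DX' X'M \<open>D \<noteq> {}\<close> f disc unfolding X
    by (metis order_trans)
  let ?K = "X closure_of N"
  have NX: "N \<subseteq> topspace X"
    using N(2) DX' X'M top by blast
  have NK: "N \<subseteq> ?K"
    using NX by (rule closure_of_subset)
  have K: "closedin X ?K"
    by simp
  have topK: "topspace (subtopology X ?K) = ?K"
    using closure_of_subset_topspace[of X N] by auto
  have "subtopology X ?K closure_of N = ?K"
    using NK by (simp add: closure_of_subtopology Int_absorb1)
  then have sep: "separable_space (subtopology X ?K)"
    unfolding separable_space_def topK using N(1) NK by blast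
  have "Sigma02_measurable_map (subtopology X ?K) Y f"
    unfolding Sigma02_measurable_map_def topK
  proof (intro conjI allI impI)
    show "f \<in> ?K \<rightarrow> topspace Y"
      using f closedin_subset[OF K] top by auto
    fix U assume "openin Y U"
    then have "fsigma_in X {x \<in> topspace X. f x \<in> U}"
      using assms(5) by (simp add: Sigma02_measurable_map_def)
    moreover have "{x \<in> ?K. f x \<in> U} = {x \<in> topspace X. f x \<in> U} \<inter> ?K"
      using closedin_subset[OF K] by auto
    ultimately show "fsigma_in (subtopology X ?K) {x \<in> ?K. f x \<in> U}"
      unfolding fsigma_in_subtopology by blast
  qed
  \<comment> \<open>Being closed in a completely Baire space, \<open>?K\<close> is a Baire space, so
    the category argument applies to its dense subset \<open>N\<close>.\<close>
  moreover have "\<not> piecewise_continuous_map (subtopology X ?K) Y f"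
    using assms(2) K NX N(3) ndisc unfolding completely_Baire_space_def
    by (intro Baire_not_piecewise_continuous) auto
  ultimately show ?thesis
    using K zd sep by blast
qed

end
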